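(* Let $1\le p<\infty$ and let $f\in B\mathcal S^p$ have a Fourier series of the symmetric form $(\ast)$ described in the context. Then for all $n\in\mathbb N$ and $\alpha>0$, $$\omega_\alpha^p\Big(f,\frac{\pi}{\lambda_n}\Big)_{B\mathcal S^p}\le\Big(\frac{\pi}{\lambda_n}\Big)^{\alpha p}\sum_{\nu=1}^{n}\big(\lambda_\nu^{\alpha p}-\lambda_{\nu-1}^{\alpha p}\big)E_{\lambda_\nu}^p(f)_{B\mathcal S^p}.$$
   Context: A function $f:\mathbb R\to\mathbb C$, summable on each finite interval, is called $B$-almost periodic (Besicovitch almost periodic of order 1) if there are trigonometric sums $\tau_N(x)=\sum_{k=1}^{N}a_ke^{\mathrm i\mu_kx}$ ($\mu_k\in\mathbb R$, $a_k\in\mathbb C$) with $\lim_{N\to\infty}\limsup_{T\to\infty}\frac1{2T}\int_{-T}^{T}|f(x)-\tau_N(x)|\,\mathrm dx=0$. For such $f$ the mean value $M\{f\}=\lim_{T\to\infty}\frac1T\int_0^Tf(x)\,\mathrm dx$ exists, and $\lambda\mapsto M\{f(\cdot)e^{-\mathrm i\lambda\cdot}\}$ is non-zero for at most countably many $\lambda\in\mathbb R$ (the Fourier exponents of $f$); its values there are the Fourier coefficients of $f$. For $1\le p<\infty$, $B\mathcal S^p$ is the space of $B$-almost periodic functions whose Fourier coefficients have finite $\ell_p$-norm; this norm is denoted $\|f\|_{B\mathcal S^p}$. Functions with the same Fourier coefficients are identified. Only those functions of $B\mathcal S^p$ are considered whose sequence of Fourier exponents has its only limit point at infinity. For such $f$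 the Fourier series is written in the symmetric form $$(\ast)\qquad S[f](x)=\sum_{k\in\mathbb Z}A_ke^{\mathrm i\lambda_kx},\quad A_k=A_k(f)=M\{f(\cdot)e^{-\mathrm i\lambda_k\cdot}\},$$ where $\lambda_0:=0$, $\lambda_{-k}=-\lambda_k$, $|A_k|+|A_{-k}|>0$, and $\lambda_{k+1}>\lambda_k>0$ for $k>0$. Best approximation: $E_{\lambda_n}(f)_{B\mathcal S^p}=\inf_{g\in G_{\lambda_n}}\|f-g\|_{B\mathcal S^p}$, where $G_{\lambda_n}$ is the set of $B$-almost periodic functions with all Fourier exponents in $(-\lambda_n,\lambda_n)$; one has $E_{\lambda_n}^p(f)_{B\mathcal S^p}=\sum_{|k|\ge n}|A_k(f)|^p$. Modulus of smoothness of order $\alpha>0$: $$\omega_\alpha(f,\delta)_{B\mathcal S^p}=\sup_{|h|\le\delta}\Big\|\sum_{j=0}^\infty(-1)^j\binom{\alpha}{j}f(\cdot-jh)\Big\|_{B\mathcal S^p}=\sup_{|h|\le\delta}\Big(\sum_{k\in\mathbb Z}2^{\alpha p}\Big|\sin\frac{\lambda_kh}2\Big|^{\alpha p}|A_k(f)|^p\Big)^{1/p}.$$ *)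

theory Defs
  imports "HOL-Analysis.Analysis"
begin

text \<open>
  The trigonometric sums \<open>\<tau>\<^sub>N\<close> may have coefficients and frequencies depending on \<open>N\<close>; since
  frequencies may repeat and coefficients may vanish, prescribing at most \<open>N\<close> terms is no restriction.
\<close>

definition trig_sum :: "nat \<Rightarrow> (nat \<Rightarrow> complex) \<Rightarrow> (nat \<Rightarrow> real) \<Rightarrow> real \<Rightarrow> complex" where
  "trig_sum N a \<mu> x = (\<Sum>k=1..N. a k * exp (\<i> * of_real (\<mu> k * x)))"

definition B_almost_periodic :: "(real \<Rightarrow> complex) \<Rightarrow> bool" where
  "B_almost_periodic f \<longleftrightarrow>
     (\<forall>a b. f absolutely_integrable_on {a..b}) \<and>
     (\<exists>(a :: nat \<Rightarrow> nat \<Rightarrow> complex) (\<mu> :: nat \<Rightarrow> nat \<Rightarrow> real).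
        (\<lambda>N. Limsup at_top (\<lambda>T::real. ereal
            (1 / (2 * T) * integral {-T..T} (\<lambda>x. norm (f x - trig_sum N (a N) (\<mu> N) x)))))
          \<longlonglongrightarrow> 0)"

definition mean_value :: "(real \<Rightarrow> complex) \<Rightarrow> complex" where
  "mean_value f = Lim at_top (\<lambda>T::real. of_real (1 / T) * integral {0..T} f)"

definition fourier_coeff :: "(real \<Rightarrow> complex) \<Rightarrow> real \<Rightarrow> complex" where
  "fourier_coeff f l = mean_value (\<lambda>x. f x * exp (- \<i> * of_real (l * x)))"

definition fourier_exponents :: "(real \<Rightarrow> complex) \<Rightarrow> real set" where
  "fourier_exponents f = {l. fourier_coeff f l \<noteq> 0}"

text \<open>
  The \<open>\<ell>\<^sub>p\<close>-norm of the Fourier coefficients is taken over all real frequencies; all but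
  countably many of the summands are zero. Functions with the same Fourier coefficients
  are not factored out, but \<open>BS_norm\<close> does not distinguish them.
\<close>

definition BS :: "real \<Rightarrow> (real \<Rightarrow> complex) set" where
  "BS p = {f. B_almost_periodic f \<and>
              (\<lambda>l. norm (fourier_coeff f l) powr p) summable_on UNIV}"

definition BS_norm :: "real \<Rightarrow> (real \<Rightarrow> complex) \<Rightarrow> real" where
  "BS_norm p f = (\<Sum>\<^sub>\<infinity>l\<in>UNIV. norm (fourier_coeff f l) powr p) powr (1 / p)"

text \<open>
  The two-sided sequence \<open>lam\<close> enumerates the Fourier exponents of \<open>f\<close> together with their
  negatives and 0; here 0 itself need not be an exponent.
\<close>

definition symmetric_form :: "(real \<Rightarrow> complex) \<Rightarrow> (int \<Rightarrow> real) \<Rightarrow> bool" where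
  "symmetric_form f lam \<longleftrightarrow>
     lam 0 = 0 \<and>
     (\<forall>k. lam (- k) = - lam k) \<and>
     (\<forall>k>0. norm (fourier_coeff f (lam k)) + norm (fourier_coeff f (lam (- k))) > 0) \<and>
     (\<forall>k>0. lam (k + 1) > lam k \<and> lam k > 0) \<and>
     fourier_exponents f \<subseteq> range lam \<and>
     (\<forall>x. \<not> x islimpt fourier_exponents f)"

definition G :: "real \<Rightarrow> (real \<Rightarrow> complex) set" where
  "G s = {g. B_almost_periodic g \<and> fourier_exponents g \<subseteq> {-s<..<s}}"

text \<open>
  The infimum runs over those \<open>g\<close> for which the norm of \<open>f - g\<close> is finite (elsewhere the
  infinite sum defining \<open>BS_norm\<close> would take its default value 0).
\<close>

definition best_approx :: "real \<Rightarrow> real \<Rightarrow> (real \<Rightarrow> complex) \<Rightarrow> real" where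
  "best_approx p s f =
     (INF g \<in> {g \<in> G s. (\<lambda>x. f x - g x) \<in> BS p}. BS_norm p (\<lambda>x. f x - g x))"

text \<open>
  The series is summed pointwise. For \<open>\<alpha> > 0\<close> and \<open>f\<close> \<open>B\<close>-almost periodic it converges
  absolutely at almost every \<open>x\<close>, because the binomial coefficients are \<open>O(j powr (-1-\<alpha>))\<close> and
  the integral of \<open>norm f\<close> over \<open>{-T..T}\<close> is \<open>O(T)\<close>.
\<close>

definition fractional_difference ::
    "real \<Rightarrow> real \<Rightarrow> (real \<Rightarrow> complex) \<Rightarrow> real \<Rightarrow> complex" where
  "fractional_difference \<alpha> h f x =
     (\<Sum>j. (-1) ^ j * of_real (\<alpha> gchoose j) * f (x - real j * h))"

definition modulus_of_smoothness ::
    "real \<Rightarrow> real \<Rightarrow> (real \<Rightarrow> complex) \<Rightarrow> real \<Rightarrow> real" where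
  "modulus_of_smoothness p \<alpha> f \<delta> =
     (SUP h \<in> {h. \<bar>h\<bar> \<le> \<delta>}. BS_norm p (fractional_difference \<alpha> h f))"

end

theory Submission imports Defs begin

text \<open>
  The fractional difference \<open>\<Delta>\<close> of order \<open>\<alpha>\<close> and step \<open>h\<close> multiplies the Fourier
  coefficient at the frequency \<open>l\<close> by a number of modulus
  \<open>(2 * \<bar>sin (l * h / 2)\<bar>) powr \<alpha>\<close>. If \<open>\<bar>l\<bar> = \<lambda> m\<close> and \<open>\<bar>h\<bar> \<le> pi / \<lambda> n\<close>, this is at most
  \<open>(pi / \<lambda> n) powr \<alpha> * \<lambda> (min m n) powr \<alpha>\<close>. The \<open>p\<close>-th power of the second factor is the
  telescoping sum of the increments \<open>\<lambda> \<nu> powr (\<alpha> * p) - \<lambda> (\<nu> - 1) powr (\<alpha> * p)\<close> over the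
  \<open>\<nu> \<le> n\<close> with \<open>\<lambda> \<nu> \<le> \<bar>l\<bar>\<close>. Summing over all frequencies and exchanging the two sums turns
  the condition \<open>\<lambda> \<nu> \<le> \<bar>l\<bar>\<close> into the tails of the sum of
  \<open>norm (fourier_coeff f l) powr p\<close>, and each tail is at most the \<open>p\<close>-th power of the best
  approximation (\<open>tail_le_best_approx\<close>).

  The analytic core is the action of \<open>\<Delta>\<close> on Fourier coefficients
  (\<open>norm_fourier_coeff_fractional_difference\<close>), because the difference is a pointwise
  infinite series of translates \<open>f (x - j * h)\<close> and a \<open>B\<close>-almost periodic function is only
  controlled in the mean over \<open>{-T..T}\<close>. The integral of \<open>norm (f (x - j * h))\<close> over
  \<open>{0..T}\<close> need therefore not be bounded by a multiple of \<open>T\<close> uniformly in \<open>j\<close>; but the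
  sum of these integrals over the first \<open>j\<close> translates is \<open>O(j * T)\<close>
  (\<open>sum_integral_shifts_le\<close>). Since the absolute binomial coefficients \<open>c j\<close> are
  eventually decreasing, summable, and satisfy \<open>j * c j \<longlonglongrightarrow> 0\<close>, summation by parts
  (\<open>abel_tail_bound\<close>) makes the tails of the series small uniformly in \<open>T \<ge> 1\<close>. Hence the
  series converges almost everywhere, can be integrated termwise, and its mean value is
  the sum of the mean values of the translates (\<open>fourier_coeff_series_of_shifts\<close>). The
  value of the multiplier is the binomial series on the unit circle
  (\<open>norm_binomial_series_unit_circle\<close>).
\<close>

section \<open>Generalised binomial coefficients\<close>

text \<open>
  Every quantitative fact about the coefficients \<open>c j = \<bar>\<alpha> gchoose j\<bar>\<close> used below comes
  from this identity: for \<open>j \<ge> \<alpha>\<close> the numbers \<open>\<alpha> * c j\<close> are the decrements of the sequence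
  \<open>j * c j\<close>.
\<close>

lemma abs_gbinomial_Suc:
  fixes \<alpha> :: real
  assumes "\<alpha> \<le> real j"
  shows "\<alpha> * \<bar>\<alpha> gchoose j\<bar> = real j * \<bar>\<alpha> gchoose j\<bar> - real (Suc j) * \<bar>\<alpha> gchoose Suc j\<bar>"
proof -
  have "real (Suc j) * (\<alpha> gchoose Suc j) = - ((real j - \<alpha>) * (\<alpha> gchoose j))"
    using gbinomial_mult_1[of \<alpha> j] by (simp add: algebra_simps)
  then have "real (Suc j) * \<bar>\<alpha> gchoose Suc j\<bar> = (real j - \<alpha>) * \<bar>\<alpha> gchoose j\<bar>"
    using assms by (metis abs_minus abs_mult abs_of_nat abs_of_nonneg diff_ge_0_iff_ge)
  then show ?thesis by (simp add: algebra_simps)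
qed

lemma abs_gbinomial_decreasing:
  fixes \<alpha> :: real
  assumes "\<alpha> > 0" "\<alpha> \<le> real j"
  shows "\<bar>\<alpha> gchoose Suc j\<bar> \<le> \<bar>\<alpha> gchoose j\<bar>"
proof -
  have "real (Suc j) * \<bar>\<alpha> gchoose Suc j\<bar> = (real j - \<alpha>) * \<bar>\<alpha> gchoose j\<bar>"
    using abs_gbinomial_Suc[OF assms(2)] by (simp add: algebra_simps)
  also have "\<dots> \<le> real (Suc j) * \<bar>\<alpha> gchoose j\<bar>"
    using assms by (intro mult_right_mono) auto
  finally show ?thesis by (simp only: mult_le_cancel_left_pos of_nat_0_less_iff zero_less_Suc)
qed

text \<open>
  The sequence \<open>j * c j\<close> is eventually decreasing, hence converges, and its decrements
  telescope; this gives summability. A positive limit \<open>L\<close> would force \<open>c j \<ge> L / j\<close> and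
  contradict the divergence of the harmonic series.
\<close>

lemma
  fixes \<alpha> :: real
  assumes "\<alpha> > 0"
  shows summable_abs_gbinomial: "summable (\<lambda>j. \<bar>\<alpha> gchoose j\<bar>)"
    and index_mult_abs_gbinomial_tendsto_0: "(\<lambda>j. real j * \<bar>\<alpha> gchoose j\<bar>) \<longlonglongrightarrow> 0"
proof -
  define c where "c j = \<bar>\<alpha> gchoose j\<bar>" for j
  define J where "J = nat \<lceil>\<alpha>\<rceil>"
  define u where "u j = real (j + J) * c (j + J)" for j
  have step: "\<alpha> * c (j + J) = u j - u (Suc j)" for j
    unfolding u_def c_def
    using abs_gbinomial_Suc[of \<alpha> "j + J"] by (simp add: J_def) linarith
  have "\<alpha> * c (j + J) \<ge> 0" for j using assms by (simp add: c_def)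
  then have dec: "decseq u"
    unfolding decseq_Suc_iff using step by (metis diff_ge_0_iff_ge)
  have nonneg: "0 \<le> u j" for j by (simp add: u_def c_def)
  from dec nonneg obtain L where L: "u \<longlonglongrightarrow> L" "\<And>j. L \<le> u j"
    using decseq_convergent[of u 0] by blast
  have "(\<lambda>j. \<alpha> * c (j + J)) sums (u 0 - L)"
    unfolding step using telescope_sums'[OF L(1)] .
  then have "summable (\<lambda>j. \<alpha> * c (j + J))" by (rule sums_summable)
  then have "summable (\<lambda>j. c (j + J))" using assms by (simp add: summable_cmult_iff)
  then show sm: "summable (\<lambda>j. \<bar>\<alpha> gchoose j\<bar>)"
    unfolding c_def using summable_iff_shift[of "\<lambda>j. \<bar>\<alpha> gchoose j\<bar>" J] by blast
  have "L = 0"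
  proof (rule ccontr)
    assume "L \<noteq> 0"
    have "L \<ge> 0" using L(1) nonneg by (intro LIMSEQ_le_const) auto
    with \<open>L \<noteq> 0\<close> have "L > 0" by simp
    have "summable (\<lambda>j. inverse (real (j + J)))"
    proof (rule summable_comparison_test')
      show "summable (\<lambda>j. c (j + J) / L)"
        using \<open>summable (\<lambda>j. c (j + J))\<close> by (rule summable_divide)
      show "norm (inverse (real (j + J))) \<le> c (j + J) / L" if "j \<ge> 1" for j
        using L(2)[of j] that \<open>L > 0\<close> by (simp add: u_def field_simps)
    qed
    then have "summable (\<lambda>j. inverse (real j))"
      using summable_iff_shift[of "\<lambda>j. inverse (real j)" J] by blast
    then show False using not_summable_harmonic[where 'a=real] by contradiction
  qed
  then show "(\<lambda>j. real j * \<bar>\<alpha> gchoose j\<bar>) \<longlonglongrightarrow> 0"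
    using L(1) LIMSEQ_offset[of "\<lambda>j. real j * \<bar>\<alpha> gchoose j\<bar>" J 0]
    unfolding u_def c_def by (simp only:)
qed

text \<open>
  Summation by parts: for decreasing weights \<open>c\<close> only the linear growth of the partial
  sums of \<open>F\<close> matters, and the worst case is \<open>F i = B\<close>, up to a boundary term. The
  right-hand side depends on \<open>F\<close> through \<open>B\<close> only, which is the source of all uniformity
  below.
\<close>

lemma abel_tail_bound:
  fixes c F :: "nat \<Rightarrow> real"
  assumes F: "\<And>i. 0 \<le> F i" and S: "\<And>j. (\<Sum>i=1..j. F i) \<le> B * real j"
    and c: "\<And>j. 0 \<le> c j" and dec: "\<And>j. J \<le> j \<Longrightarrow> c (Suc j) \<le> c j"
  shows "(\<Sum>i=Suc J..N. c i * F i) \<le> B * (real J * c J + (\<Sum>i=Suc J..N. c i))"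
proof -
  have B: "B \<ge> 0" using S[of 1] F[of 1] by simp
  show ?thesis
  proof (cases "J \<le> N")
    case True
    then have "(\<Sum>i=Suc J..N. c i * F i) + c N * (B * real N - (\<Sum>i=1..N. F i))
        \<le> B * (real J * c J + (\<Sum>i=Suc J..N. c i))"
    proof (induction N rule: dec_induct)
      case base
      have "0 \<le> (\<Sum>i=1..J. F i) * c J" using F c by (simp add: sum_nonneg)
      then show ?case by (simp add: algebra_simps)
    next
      case (step N)
      have "c (Suc N) * (B * real N - (\<Sum>i=1..N. F i)) \<le> c N * (B * real N - (\<Sum>i=1..N. F i))"
        using dec[OF step.hyps(1)] S[of N] by (intro mult_right_mono) auto
      with step show ?case by (simp add: algebra_simps)
    qed
    moreover have "0 \<le> c N * (B * real N - (\<Sum>i=1..N. F i))"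
      using c[of N] S[of N] by simp
    ultimately show ?thesis by linarith
  next
    case False
    then show ?thesis using B c by simp
  qed
qed

text \<open>
  Inside the disc this is the binomial theorem. Summability of the coefficients makes the
  series converge uniformly along the radius towards \<open>w\<close>, and \<open>norm (1 - r * w) powr \<alpha>\<close> is
  continuous up to \<open>r = 1\<close>, even for \<open>w = 1\<close>, since \<open>\<alpha> > 0\<close>. Only the norm is of interest,
  which avoids the branch cut of the complex power on the boundary.
\<close>

lemma norm_binomial_series_unit_circle:
  fixes \<alpha> :: real and w :: complex
  assumes "\<alpha> > 0" "norm w = 1"
  shows "norm (\<Sum>j. (-1) ^ j * of_real (\<alpha> gchoose j) * w ^ j) = norm (1 - w) powr \<alpha>"
proof -
  define a where "a j = (-1) ^ j * complex_of_real (\<alpha> gchoose j) * w ^ j" for j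
  have na: "norm (a j * of_real r ^ j) \<le> \<bar>\<alpha> gchoose j\<bar>" if "r \<in> {0..<1}" for j and r :: real
  proof -
    have "norm (a j * of_real r ^ j) = \<bar>\<alpha> gchoose j\<bar> * r ^ j"
      using that assms by (simp add: a_def norm_mult norm_power)
    also have "\<dots> \<le> \<bar>\<alpha> gchoose j\<bar> * 1"
      using that by (intro mult_left_mono power_le_one) auto
    finally show ?thesis by simp
  qed
  have sa: "summable a"
    using summable_abs_gbinomial[OF assms(1)] assms(2)
    by (intro summable_norm_cancel[of a]) (simp add: a_def norm_mult norm_power)
  have inner: "(\<Sum>j. a j * of_real r ^ j) = (1 - of_real r * w) powr of_real \<alpha>"
    if "r \<in> {0..<1}" for r :: real
  proof -
    have "norm (- (of_real r * w)) < 1" using that assms by (simp add: norm_mult)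
    from gen_binomial_complex[OF this, of "of_real \<alpha>"]
    have "(\<lambda>j. (complex_of_real \<alpha> gchoose j) * (- (of_real r * w)) ^ j) sums
        (1 - of_real r * w) powr of_real \<alpha>" by simp
    also have "(\<lambda>j. (complex_of_real \<alpha> gchoose j) * (- (of_real r * w)) ^ j) =
        (\<lambda>j. a j * of_real r ^ j)"
    proof
      fix j
      have "(- (of_real r * w)) ^ j = (-1) ^ j * w ^ j * of_real r ^ j"
        by (subst power_minus) (simp add: power_mult_distrib mult_ac)
      moreover have "complex_of_real \<alpha> gchoose j = of_real (\<alpha> gchoose j)"
        by (simp add: gbinomial_prod_rev)
      ultimately show "(complex_of_real \<alpha> gchoose j) * (- (of_real r * w)) ^ j = a j * of_real r ^ j"
        by (simp add: a_def mult_ac)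
    qed
    finally show ?thesis by (rule sums_unique[symmetric])
  qed
  have ul: "uniform_limit {0..<1} (\<lambda>N r. \<Sum>j<N. a j * of_real r ^ j)
      (\<lambda>r::real. \<Sum>j. a j * of_real r ^ j) sequentially"
    using na by (intro Weierstrass_m_test[OF _ summable_abs_gbinomial[OF assms(1)]]) auto
  have ev: "eventually (\<lambda>r::real. r \<in> {0..<1}) (at_left 1)"
    using eventually_at_left_real[of 0 "1::real"] by (auto elim: eventually_mono)
  have "((\<lambda>r::real. \<Sum>j. a j * of_real r ^ j) \<longlongrightarrow> (\<Sum>j. a j)) (at_left 1)"
  proof (rule swap_uniform_limit'[OF _ _ ul ev])
    show "\<forall>\<^sub>F N in sequentially. ((\<lambda>r::real. \<Sum>j<N. a j * of_real r ^ j) \<longlongrightarrow> (\<Sum>j<N. a j)) (at_left 1)"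
    proof (intro always_eventually allI)
      fix N
      have "((\<lambda>r::real. \<Sum>j<N. a j * of_real r ^ j) \<longlongrightarrow> (\<Sum>j<N. a j * of_real 1 ^ j)) (at_left 1)"
        by (intro tendsto_intros)
      then show "((\<lambda>r::real. \<Sum>j<N. a j * of_real r ^ j) \<longlongrightarrow> (\<Sum>j<N. a j)) (at_left 1)" by simp
    qed
    show "(\<lambda>N. \<Sum>j<N. a j) \<longlonglongrightarrow> (\<Sum>j. a j)" using sa by (rule summable_LIMSEQ)
  qed simp
  then have "((\<lambda>r::real. norm (\<Sum>j. a j * of_real r ^ j)) \<longlongrightarrow> norm (\<Sum>j. a j)) (at_left 1)"
    by (rule tendsto_norm)
  moreover have "eventually (\<lambda>r::real. norm (\<Sum>j. a j * of_real r ^ j) =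
      norm (1 - of_real r * w) powr \<alpha>) (at_left 1)"
    using ev by eventually_elim (simp add: inner norm_powr_real_powr')
  ultimately have "((\<lambda>r::real. norm (1 - of_real r * w) powr \<alpha>) \<longlongrightarrow> norm (\<Sum>j. a j)) (at_left 1)"
    by (rule Lim_transform_eventually)
  moreover have "((\<lambda>r::real. norm (1 - of_real r * w) powr \<alpha>) \<longlongrightarrow> norm (1 - w) powr \<alpha>) (at_left 1)"
  proof (rule tendsto_powr')
    have "((\<lambda>r::real. norm (1 - of_real r * w)) \<longlongrightarrow> norm (1 - of_real 1 * w)) (at_left 1)"
      by (intro tendsto_intros)
    then show "((\<lambda>r::real. norm (1 - of_real r * w)) \<longlongrightarrow> norm (1 - w)) (at_left 1)" by simp
  qed (use assms in auto)
  ultimately have "norm (\<Sum>j. a j) = norm (1 - w) powr \<alpha>"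
    by (intro tendsto_unique[OF trivial_limit_at_left_real])
  then show ?thesis by (simp only: a_def)
qed

lemma norm_one_minus_cis: "norm (1 - exp (- \<i> * of_real t)) = 2 * \<bar>sin (t / 2)\<bar>"
proof -
  have "1 - exp (- \<i> * complex_of_real t) = 1 - cis (- t)"
    unfolding cis_conv_exp by simp
  moreover have "norm (1 - cis (-t)) ^ 2 = (2 * \<bar>sin (t / 2)\<bar>) ^ 2"
  proof -
    have "norm (1 - cis (-t)) ^ 2 = (1 - cos t)\<^sup>2 + (sin t)\<^sup>2"
      by (simp add: cmod_power2)
    also have "\<dots> = 2 - 2 * cos t"
      using sin_cos_squared_add[of t] by (simp add: power2_diff)
    also have "\<dots> = (2 * \<bar>sin (t / 2)\<bar>) ^ 2"
      using cos_double_sin[of "t/2"] by (simp add: power_mult_distrib)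
    finally show ?thesis .
  qed
  ultimately have "norm (1 - exp (- \<i> * complex_of_real t)) ^ 2 = (2 * \<bar>sin (t / 2)\<bar>) ^ 2"
    by simp
  then show ?thesis by (rule power2_eq_imp_eq) auto
qed

section \<open>Mean values of almost periodic functions\<close>

lemma absolutely_integrable_mult_character:
  fixes f :: "real \<Rightarrow> complex"
  assumes "f absolutely_integrable_on {a..b}"
  shows "(\<lambda>x. f x * exp (- \<i> * of_real (l * x))) absolutely_integrable_on {a..b}"
proof -
  have f: "integrable (lebesgue_on {a..b}) f"
    using assms by (simp add: set_integrable_eq)
  have "integrable (lebesgue_on {a..b}) (\<lambda>x. f x * exp (- \<i> * of_real (l * x)))"
  proof (rule Bochner_Integration.integrable_bound[OF f])
    have "(\<lambda>x. exp (- \<i> * complex_of_real (l * x))) \<in> borel_measurable (lebesgue_on {a..b})"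
      by (intro continuous_imp_measurable_on_sets_lebesgue continuous_intros) auto
    then show "(\<lambda>x. f x * exp (- \<i> * of_real (l * x))) \<in> borel_measurable (lebesgue_on {a..b})"
      by (intro borel_measurable_times borel_measurable_integrable[OF f])
  qed (simp add: norm_mult)
  then show ?thesis by (simp add: set_integrable_eq)
qed

lemma
  fixes f :: "real \<Rightarrow> complex"
  assumes "\<And>a b. f absolutely_integrable_on {a..b}"
  shows absolutely_integrable_shift: "(\<lambda>x. f (x - s)) absolutely_integrable_on {a..b}"
    and integral_norm_shift: "integral {a..b} (\<lambda>x. norm (f (x - s))) = integral {a-s..b-s} (\<lambda>x. norm (f x))"
proof -
  have *: "f \<circ> (+) (-s) = (\<lambda>x. f (x - s))" "(\<lambda>x. norm (f x)) \<circ> (+) (-s) = (\<lambda>x. norm (f (x - s)))"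
    by (auto simp: fun_eq_iff)
  show "(\<lambda>x. f (x - s)) absolutely_integrable_on {a..b}"
    using assms[of "a - s" "b - s"] integrable_on_shift_Icc_real[of f "-s" a b]
      integrable_on_shift_Icc_real[of "\<lambda>x. norm (f x)" "-s" a b]
    unfolding absolutely_integrable_on_def * by simp
  show "integral {a..b} (\<lambda>x. norm (f (x - s))) = integral {a-s..b-s} (\<lambda>x. norm (f x))"
    using integral_shift_Icc_real[of a b "\<lambda>x. norm (f x)" "-s"] unfolding * by simp
qed

lemma continuous_on_trig_sum: "continuous_on S (trig_sum N a \<mu>)"
  unfolding trig_sum_def by (intro continuous_intros)

lemma B_almost_periodic_approx:
  assumes "B_almost_periodic f" "e > 0"
  obtains N a \<mu> where
    "eventually (\<lambda>T. integral {-T..T} (\<lambda>x. norm (f x - trig_sum N a \<mu> x)) \<le> e * T) at_top"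
proof -
  obtain a \<mu> where lim: "(\<lambda>N. Limsup at_top (\<lambda>T::real. ereal
      (1 / (2 * T) * integral {-T..T} (\<lambda>x. norm (f x - trig_sum N (a N) (\<mu> N) x))))) \<longlonglongrightarrow> 0"
    using assms(1) unfolding B_almost_periodic_def by blast
  have "0 < ereal (e / 2)" using assms(2) by simp
  from order_tendstoD(2)[OF lim this] obtain N where
    "Limsup at_top (\<lambda>T::real. ereal
      (1 / (2 * T) * integral {-T..T} (\<lambda>x. norm (f x - trig_sum N (a N) (\<mu> N) x)))) < ereal (e / 2)"
    by (auto simp: eventually_sequentially)
  then have "eventually (\<lambda>T. ereal (1 / (2 * T) *
      integral {-T..T} (\<lambda>x. norm (f x - trig_sum N (a N) (\<mu> N) x))) < ereal (e / 2)) at_top"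
    by (rule Limsup_lessD)
  then have "eventually (\<lambda>T. integral {-T..T} (\<lambda>x. norm (f x - trig_sum N (a N) (\<mu> N) x)) \<le> e * T) at_top"
    using eventually_gt_at_top[of 0] by eventually_elim (simp add: field_simps)
  then show ?thesis by (rule that)
qed

text \<open>
  A trigonometric sum at distance at most 1 in mean is bounded, so the integral of
  \<open>norm f\<close> over \<open>{-T..T}\<close> is \<open>O(T)\<close> for large \<open>T\<close>; enlarging the constant covers small
  \<open>T\<close>. The integrals over the translates of a fixed interval may be unbounded.
\<close>

lemma B_almost_periodic_growth:
  assumes "B_almost_periodic f"
  obtains C where "C \<ge> 0" "\<And>T. T \<ge> 0 \<Longrightarrow> integral {-T..T} (\<lambda>x. norm (f x)) \<le> C * (T + 1)"
proof -
  obtain N a \<mu> where "eventually (\<lambda>T. integral {-T..T} (\<lambda>x. norm (f x - trig_sum N a \<mu> x)) \<le> 1 * T) at_top"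
    using B_almost_periodic_approx[OF assms, of 1] by auto
  then obtain T0 where T0: "\<And>T. T \<ge> T0 \<Longrightarrow> integral {-T..T} (\<lambda>x. norm (f x - trig_sum N a \<mu> x)) \<le> 1 * T"
    unfolding eventually_at_top_linorder by blast
  have f: "f absolutely_integrable_on {u..v}" for u v
    using assms unfolding B_almost_periodic_def by blast
  then have nf: "(\<lambda>x. norm (f x)) integrable_on {u..v}" for u v
    by (simp add: absolutely_integrable_on_def)
  have tau: "trig_sum N a \<mu> absolutely_integrable_on {u..v}" for u v
    by (intro absolutely_integrable_continuous_real continuous_on_trig_sum)
  have d: "(\<lambda>x. norm (f x - trig_sum N a \<mu> x)) integrable_on {u..v}" for u v
    using set_integral_diff(1)[OF f tau] by (simp add: absolutely_integrable_on_def)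
  define A where "A = (\<Sum>k=1..N. norm (a k))"
  have A: "A \<ge> 0" by (simp add: A_def sum_nonneg)
  have tau_le: "norm (trig_sum N a \<mu> x) \<le> A" for x
    unfolding trig_sum_def A_def by (rule order_trans[OF norm_sum]) (simp add: norm_mult)
  define T1 where "T1 = max T0 0"
  then have T1: "T1 \<ge> 0" by simp
  have large: "integral {-T..T} (\<lambda>x. norm (f x)) \<le> (1 + 2 * A) * T" if "T \<ge> T1" for T
  proof -
    have "integral {-T..T} (\<lambda>x. norm (f x)) \<le> integral {-T..T} (\<lambda>x. norm (f x - trig_sum N a \<mu> x) + A)"
    proof (intro integral_le nf integrable_add d)
      show "norm (f x) \<le> norm (f x - trig_sum N a \<mu> x) + A" for x
        using tau_le[of x] norm_triangle_sub[of "f x" "trig_sum N a \<mu> x"] by linarith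
    qed auto
    also have "\<dots> = integral {-T..T} (\<lambda>x. norm (f x - trig_sum N a \<mu> x)) + 2 * T * A"
      using that by (subst Henstock_Kurzweil_Integration.integral_add[OF d]) (auto simp: T1_def)
    finally show ?thesis using T0[of T] that by (simp add: T1_def algebra_simps)
  qed
  define C where "C = (1 + 2 * A) * (T1 + 1)"
  show ?thesis
  proof (rule that)
    show "C \<ge> 0" using A by (simp add: C_def T1_def)
    fix T :: real assume T: "T \<ge> 0"
    show "integral {-T..T} (\<lambda>x. norm (f x)) \<le> C * (T + 1)"
    proof (cases "T \<ge> T1")
      case True
      have "(1 + 2 * A) * T \<le> (1 + 2 * A) * ((T1 + 1) * (T + 1))"
        using A T mult_nonneg_nonneg[OF T1 T] T1 by (intro mult_left_mono) (auto simp: algebra_simps)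
      then show ?thesis using large[OF True] by (simp add: C_def mult.assoc)
    next
      case False
      have "integral {-T..T} (\<lambda>x. norm (f x)) \<le> integral {-T1..T1} (\<lambda>x. norm (f x))"
        using False by (intro integral_subset_le nf) auto
      also have "\<dots> \<le> (1 + 2 * A) * T1" by (rule large) simp
      also have "\<dots> \<le> (1 + 2 * A) * ((T1 + 1) * (T + 1))"
        using A T mult_nonneg_nonneg[OF T1 T] T1 by (intro mult_left_mono) (auto simp: algebra_simps)
      finally show ?thesis by (simp add: C_def mult.assoc)
    qed
  qed
qed

lemma mean_exp_convergent:
  "\<exists>L. ((\<lambda>T::real. of_real (1 / T) * integral {0..T} (\<lambda>x. exp (\<i> * of_real (c * x)))) \<longlongrightarrow> L) at_top"
proof (cases "c = 0")
  case True
  have "((\<lambda>T::real. complex_of_real 1) \<longlongrightarrow> of_real 1) at_top" by simp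
  moreover have "eventually (\<lambda>T::real. complex_of_real 1 =
      of_real (1 / T) * integral {0..T} (\<lambda>x. exp (\<i> * of_real (c * x)))) at_top"
    using eventually_gt_at_top[of 0]
    by eventually_elim (simp add: True scaleR_conv_of_real)
  ultimately have "((\<lambda>T::real. of_real (1 / T) * integral {0..T} (\<lambda>x. exp (\<i> * of_real (c * x)))) \<longlongrightarrow> of_real 1) at_top"
    by (rule Lim_transform_eventually)
  then show ?thesis by blast
next
  case False
  have int: "((\<lambda>x. exp (\<i> * of_real (c * x))) has_integral
      (exp (\<i> * of_real (c * T)) / (\<i> * of_real c) - exp (\<i> * of_real (c * 0)) / (\<i> * of_real c))) {0..T}"
    if "T \<ge> 0" for T :: real
    using that
  proof (rule fundamental_theorem_of_calculus)
    fix x assume "x \<in> {0..T}"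
    have "((\<lambda>z. exp (\<i> * of_real c * z) / (\<i> * of_real c)) has_field_derivative
        exp (\<i> * of_real (c * x))) (at (of_real x))"
      using False by (auto intro!: derivative_eq_intros simp: mult.assoc)
    from has_vector_derivative_real_field[OF this]
    show "((\<lambda>x. exp (\<i> * of_real (c * x)) / (\<i> * of_real c)) has_vector_derivative
        exp (\<i> * of_real (c * x))) (at x within {0..T})"
      by (simp add: mult.assoc)
  qed
  have "((\<lambda>T::real. of_real (1 / T) * integral {0..T} (\<lambda>x. exp (\<i> * of_real (c * x)))) \<longlongrightarrow> 0) at_top"
  proof (rule Lim_null_comparison)
    show "eventually (\<lambda>T::real. norm (of_real (1 / T) * integral {0..T} (\<lambda>x. exp (\<i> * of_real (c * x))))
        \<le> (1 / T) * (2 / \<bar>c\<bar>)) at_top"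
      using eventually_gt_at_top[of 0]
    proof eventually_elim
      case (elim T)
      have "integral {0..T} (\<lambda>x. exp (\<i> * of_real (c * x))) = (exp (\<i> * of_real (c * T)) - 1) / (\<i> * of_real c)"
        using integral_unique[OF int[of T]] elim by (simp add: diff_divide_distrib)
      moreover have "norm (exp (\<i> * of_real (c * T)) - 1) \<le> 2"
        using norm_triangle_ineq4[of "exp (\<i> * of_real (c * T))" 1] by simp
      ultimately have "norm (integral {0..T} (\<lambda>x. exp (\<i> * of_real (c * x)))) \<le> 2 / \<bar>c\<bar>"
        by (simp add: norm_divide norm_mult divide_right_mono)
      then have "(1 / T) * norm (integral {0..T} (\<lambda>x. exp (\<i> * of_real (c * x)))) \<le> (1 / T) * (2 / \<bar>c\<bar>)"
        using elim by (intro mult_left_mono) auto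
      then show ?case using elim by (simp add: norm_mult norm_divide)
    qed
    show "((\<lambda>T::real. (1 / T) * (2 / \<bar>c\<bar>)) \<longlongrightarrow> 0) at_top"
      by (intro tendsto_mult_left_zero tendsto_divide_0[OF tendsto_const] filterlim_at_top_imp_at_infinity filterlim_ident)
  qed
  then show ?thesis by blast
qed

lemma mean_trig_sum_convergent:
  obtains L where "((\<lambda>T::real. of_real (1 / T) *
    integral {0..T} (\<lambda>x. trig_sum N a \<mu> x * exp (- \<i> * of_real (l * x)))) \<longlongrightarrow> L) at_top"
proof -
  have "\<exists>M. \<forall>c. ((\<lambda>T::real. of_real (1 / T) * integral {0..T} (\<lambda>x. exp (\<i> * of_real (c * x)))) \<longlongrightarrow> M c) at_top"
    by (intro choice allI mean_exp_convergent)
  then obtain M where M: "\<And>c. ((\<lambda>T::real. of_real (1 / T) * integral {0..T} (\<lambda>x. exp (\<i> * of_real (c * x)))) \<longlongrightarrow> M c) at_top"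
    by blast
  have int: "integral {0..T} (\<lambda>x. trig_sum N a \<mu> x * exp (- \<i> * of_real (l * x))) =
      (\<Sum>k=1..N. a k * integral {0..T} (\<lambda>x. exp (\<i> * of_real ((\<mu> k - l) * x))))" for T
  proof -
    have "(\<lambda>x. trig_sum N a \<mu> x * exp (- \<i> * of_real (l * x))) =
        (\<lambda>x. \<Sum>k=1..N. a k * exp (\<i> * of_real ((\<mu> k - l) * x)))"
    proof
      fix x
      have "exp (\<i> * of_real (\<mu> k * x)) * exp (- \<i> * of_real (l * x)) = exp (\<i> * of_real ((\<mu> k - l) * x))" for k
        by (simp add: exp_add[symmetric] algebra_simps)
      then show "trig_sum N a \<mu> x * exp (- \<i> * of_real (l * x)) =
          (\<Sum>k=1..N. a k * exp (\<i> * of_real ((\<mu> k - l) * x)))"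
        unfolding trig_sum_def sum_distrib_right by (simp add: mult.assoc)
    qed
    moreover have "(\<lambda>x. a k * exp (\<i> * of_real ((\<mu> k - l) * x))) integrable_on {0..T}" for k
      by (intro integrable_continuous_real continuous_intros)
    ultimately show ?thesis by (simp add: Henstock_Kurzweil_Integration.integral_sum)
  qed
  have "((\<lambda>T::real. \<Sum>k=1..N. a k * (of_real (1 / T) * integral {0..T} (\<lambda>x. exp (\<i> * of_real ((\<mu> k - l) * x)))))
      \<longlongrightarrow> (\<Sum>k=1..N. a k * M (\<mu> k - l))) at_top"
    by (intro tendsto_intros M)
  moreover have "of_real (1 / T) * (a k * z) = a k * (of_real (1 / T) * z)" for T :: real and k z
    by (rule mult.left_commute)
  ultimately show ?thesis
    by (intro that[of "\<Sum>k=1..N. a k * M (\<mu> k - l)"]) (simp only: int sum_distrib_left)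
qed

text \<open>
  Completeness: a function that has convergent functions at arbitrarily small ultimate
  distance satisfies the Cauchy criterion.
\<close>

lemma mean_convergentI:
  fixes F :: "real \<Rightarrow> complex"
  assumes "\<And>e. e > 0 \<Longrightarrow> \<exists>G L. (G \<longlongrightarrow> L) at_top \<and> eventually (\<lambda>T. dist (F T) (G T) \<le> e) at_top"
  obtains L where "(F \<longlongrightarrow> L) at_top"
proof -
  have "cauchy_filter (filtermap F at_top)"
    unfolding cauchy_filter_metric_filtermap
  proof (intro allI impI)
    fix e :: real assume "e > 0"
    then obtain G L where G: "(G \<longlongrightarrow> L) at_top" "eventually (\<lambda>T. dist (F T) (G T) \<le> e / 5) at_top"
      using assms[of "e / 5"] by auto
    have "eventually (\<lambda>T. dist (G T) L < e / 5) at_top"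
      using tendstoD[OF G(1), of "e / 5"] \<open>e > 0\<close> by simp
    with G(2) have "eventually (\<lambda>T. dist (F T) L < 2 * e / 5) at_top"
    proof eventually_elim
      case (elim T)
      then show ?case using dist_triangle[of "F T" L "G T"] by linarith
    qed
    moreover have "dist (F x) (F y) < e" if "dist (F x) L < 2 * e / 5 \<and> dist (F y) L < 2 * e / 5" for x y
      using that dist_triangle2[of "F x" "F y" L] \<open>e > 0\<close> by linarith
    ultimately show "\<exists>P. eventually P at_top \<and> (\<forall>x y. P x \<and> P y \<longrightarrow> dist (F x) (F y) < e)"
      by blast
  qed
  then obtain L where "filtermap F at_top \<le> nhds L"
    using cauchy_filter_complete_converges[of "filtermap F at_top" UNIV] complete_UNIV
    by (auto simp: filtermap_bot_iff)
  then show ?thesis by (intro that) (simp add: filterlim_def)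
qed

text \<open>
  Makes the default-valued limit in the definition of the Fourier coefficient a genuine
  one: the one-sided mean of \<open>f - \<tau>\<close> times a character is at most twice the two-sided mean
  of \<open>norm (f - \<tau>)\<close>.
\<close>

lemma fourier_coeff_tendsto:
  assumes "B_almost_periodic f"
  shows "((\<lambda>T::real. of_real (1 / T) * integral {0..T} (\<lambda>x. f x * exp (- \<i> * of_real (l * x))))
    \<longlongrightarrow> fourier_coeff f l) at_top"
proof -
  let ?F = "\<lambda>T::real. of_real (1 / T) * integral {0..T} (\<lambda>x. f x * exp (- \<i> * of_real (l * x)))"
  have f: "f absolutely_integrable_on {u..v}" for u v
    using assms unfolding B_almost_periodic_def by blast
  obtain L where L: "(?F \<longlongrightarrow> L) at_top"
  proof (rule mean_convergentI[of ?F])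
    fix e :: real assume "e > 0"
    then obtain N a \<mu> where ev:
      "eventually (\<lambda>T. integral {-T..T} (\<lambda>x. norm (f x - trig_sum N a \<mu> x)) \<le> e * T) at_top"
      by (rule B_almost_periodic_approx[OF assms])
    let ?G = "\<lambda>T::real. of_real (1 / T) * integral {0..T} (\<lambda>x. trig_sum N a \<mu> x * exp (- \<i> * of_real (l * x)))"
    have tau: "trig_sum N a \<mu> absolutely_integrable_on {u..v}" for u v
      by (intro absolutely_integrable_continuous_real continuous_on_trig_sum)
    have d: "(\<lambda>x. norm (f x - trig_sum N a \<mu> x)) integrable_on {u..v}" for u v
      using set_integral_diff(1)[OF f tau] by (simp add: absolutely_integrable_on_def)
    have "eventually (\<lambda>T. dist (?F T) (?G T) \<le> e) at_top"
      using ev eventually_gt_at_top[of 0]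
    proof eventually_elim
      case (elim T)
      have i: "(\<lambda>x. f x * exp (- \<i> * of_real (l * x))) integrable_on {0..T}"
        "(\<lambda>x. trig_sum N a \<mu> x * exp (- \<i> * of_real (l * x))) integrable_on {0..T}"
        using absolutely_integrable_mult_character[OF f] absolutely_integrable_mult_character[OF tau]
        by (auto simp: absolutely_integrable_on_def)
      have "?F T - ?G T = of_real (1 / T) * integral {0..T}
          (\<lambda>x. f x * exp (- \<i> * of_real (l * x)) - trig_sum N a \<mu> x * exp (- \<i> * of_real (l * x)))"
        using Henstock_Kurzweil_Integration.integral_diff[OF i] by (simp only: right_diff_distrib)
      moreover have "norm (integral {0..T}
          (\<lambda>x. f x * exp (- \<i> * of_real (l * x)) - trig_sum N a \<mu> x * exp (- \<i> * of_real (l * x))))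
          \<le> integral {0..T} (\<lambda>x. norm (f x - trig_sum N a \<mu> x))"
        by (intro Henstock_Kurzweil_Integration.integral_norm_bound_integral integrable_diff i d)
          (simp add: left_diff_distrib[symmetric] norm_mult)
      moreover have "integral {0..T} (\<lambda>x. norm (f x - trig_sum N a \<mu> x))
          \<le> integral {-T..T} (\<lambda>x. norm (f x - trig_sum N a \<mu> x))"
        using elim by (intro integral_subset_le d) auto
      ultimately show ?case
        using elim by (simp add: dist_norm norm_mult norm_divide field_simps)
    qed
    moreover obtain L where "(?G \<longlongrightarrow> L) at_top" using mean_trig_sum_convergent .
    ultimately show "\<exists>G L. (G \<longlongrightarrow> L) at_top \<and> eventually (\<lambda>T. dist (?F T) (G T) \<le> e) at_top"
      by blast
  qed
  moreover have "fourier_coeff f l = L"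
    unfolding fourier_coeff_def mean_value_def using tendsto_Lim[OF _ L] by simp
  ultimately show ?thesis by simp
qed

lemma fourier_coeff_diff:
  assumes "B_almost_periodic f" "B_almost_periodic g"
  shows "fourier_coeff (\<lambda>x. f x - g x) l = fourier_coeff f l - fourier_coeff g l"
proof -
  have i: "(\<lambda>x. u x * exp (- \<i> * of_real (l * x))) integrable_on {0..T}" if "B_almost_periodic u" for u T
    using that absolutely_integrable_mult_character[where f = u]
    unfolding B_almost_periodic_def absolutely_integrable_on_def by blast
  have "((\<lambda>T::real. of_real (1 / T) * integral {0..T} (\<lambda>x. (f x - g x) * exp (- \<i> * of_real (l * x))))
      \<longlongrightarrow> fourier_coeff f l - fourier_coeff g l) at_top"
    using tendsto_diff[OF fourier_coeff_tendsto[OF assms(1), of l] fourier_coeff_tendsto[OF assms(2), of l]]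
    by (simp only: left_diff_distrib right_diff_distrib
        Henstock_Kurzweil_Integration.integral_diff[OF i[OF assms(1)] i[OF assms(2)]])
  then show ?thesis
    unfolding fourier_coeff_def[of "\<lambda>x. f x - g x"] mean_value_def by (intro tendsto_Lim) auto
qed

section \<open>Integrals of many translates\<close>

text \<open>
  A fixed translation changes the interval of integration by a bounded piece at the left
  end, contributing the constant \<open>D\<close>, and replaces \<open>T\<close> by \<open>T - s\<close> at the right end.
\<close>

lemma mean_shift_tendsto:
  assumes "B_almost_periodic f"
  shows "((\<lambda>T::real. of_real (1 / T) * integral {0..T} (\<lambda>x. f (x - s) * exp (- \<i> * of_real (l * x))))
    \<longlongrightarrow> exp (- \<i> * of_real (l * s)) * fourier_coeff f l) at_top"
proof -
  define u where "u x = f x * exp (- \<i> * of_real (l * x))" for x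
  have u: "u integrable_on {a..b}" for a b
    using assms absolutely_integrable_mult_character[where f = f]
    unfolding B_almost_periodic_def absolutely_integrable_on_def u_def by blast
  have lim: "((\<lambda>T::real. of_real (1 / T) * integral {0..T} u) \<longlongrightarrow> fourier_coeff f l) at_top"
    using fourier_coeff_tendsto[OF assms, of l] by (simp add: u_def[abs_def])
  define D where "D = integral {-\<bar>s\<bar>..0} u - integral {-\<bar>s\<bar>..-s} u"
  have eq: "integral {0..T} (\<lambda>x. f (x - s) * exp (- \<i> * of_real (l * x))) =
      exp (- \<i> * of_real (l * s)) * (integral {0..T - s} u + D)" if "T \<ge> \<bar>s\<bar>" for T
  proof -
    have "(\<lambda>x. f (x - s) * exp (- \<i> * of_real (l * x))) =
        (\<lambda>x. exp (- \<i> * of_real (l * s)) * (u \<circ> (+) (-s)) x)"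
      by (auto simp: fun_eq_iff u_def exp_add[symmetric] algebra_simps)
    then have "integral {0..T} (\<lambda>x. f (x - s) * exp (- \<i> * of_real (l * x))) =
        exp (- \<i> * of_real (l * s)) * integral {0..T} (u \<circ> (+) (-s))"
      by (simp only: Henstock_Kurzweil_Integration.integral_mult_right)
    also have "integral {0..T} (u \<circ> (+) (-s)) = integral {-s..T - s} u"
      using integral_shift_Icc_real[of 0 T u "-s"] by simp
    also have "\<dots> = integral {0..T - s} u + D"
      using that Henstock_Kurzweil_Integration.integral_combine[of "-\<bar>s\<bar>" "-s" "T - s" u]
        Henstock_Kurzweil_Integration.integral_combine[of "-\<bar>s\<bar>" 0 "T - s" u] u
      by (simp add: D_def algebra_simps)
    finally show ?thesis .
  qed
  have shift: "filterlim (\<lambda>T::real. T - s) at_top at_top"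
    using filterlim_tendsto_add_at_top[OF tendsto_const[of "-s"] filterlim_ident] by simp
  have inv: "((\<lambda>T::real. 1 / T) \<longlongrightarrow> 0) at_top"
    by (intro tendsto_divide_0[OF tendsto_const] filterlim_at_top_imp_at_infinity filterlim_ident)
  have "((\<lambda>T::real. exp (- \<i> * of_real (l * s)) * (of_real (1 - s * (1 / T)) *
      (of_real (1 / (T - s)) * integral {0..T - s} u) + of_real (1 / T) * D))
      \<longlongrightarrow> exp (- \<i> * of_real (l * s)) * (of_real (1 - s * 0) * fourier_coeff f l + of_real 0 * D)) at_top"
    by (intro tendsto_intros inv filterlim_compose[OF lim shift])
  then have "((\<lambda>T::real. exp (- \<i> * of_real (l * s)) * (of_real (1 - s * (1 / T)) *
      (of_real (1 / (T - s)) * integral {0..T - s} u) + of_real (1 / T) * D))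
      \<longlongrightarrow> exp (- \<i> * of_real (l * s)) * fourier_coeff f l) at_top" by simp
  moreover have "eventually (\<lambda>T::real. exp (- \<i> * of_real (l * s)) * (of_real (1 - s * (1 / T)) *
      (of_real (1 / (T - s)) * integral {0..T - s} u) + of_real (1 / T) * D) =
      of_real (1 / T) * integral {0..T} (\<lambda>x. f (x - s) * exp (- \<i> * of_real (l * x)))) at_top"
    using eventually_gt_at_top[of "\<bar>s\<bar>"]
  proof eventually_elim
    case (elim T)
    have "(1 - s * (1 / T)) * (1 / (T - s)) = 1 / T" using elim by (simp add: field_simps)
    then have "of_real (1 - s * (1 / T)) * (of_real (1 / (T - s)) * integral {0..T - s} u) =
        of_real (1 / T) * integral {0..T - s} u"
      by (metis mult.assoc of_real_mult)
    then show ?case using elim eq[of T] by (simp add: algebra_simps)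
  qed
  ultimately show ?thesis by (rule Lim_transform_eventually)
qed

lemma card_translates_le:
  fixes h y T :: real
  assumes "h \<noteq> 0" "T \<ge> 0"
  shows "real (card {i \<in> {1..j}. y \<in> {- (real i * h)..T - real i * h}}) \<le> T / \<bar>h\<bar> + 1"
proof -
  define A where "A = {i \<in> {1..j}. y \<in> {- (real i * h)..T - real i * h}}"
  have "real (card A) \<le> T / \<bar>h\<bar> + 1"
  proof (cases "A = {}")
    case False
    have fin: "finite A" by (simp add: A_def)
    have mem: "Min A \<in> A" "Max A \<in> A" using fin False by auto
    have le: "Min A \<le> Max A" using fin False by simp
    have "card A \<le> card {Min A..Max A}"
      using fin by (intro card_mono) auto
    then have "real (card A) \<le> (real (Max A) - real (Min A)) + 1"
      using le by simp
    moreover have "\<bar>real (Max A) * h - real (Min A) * h\<bar> \<le> T"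
      using mem unfolding A_def by auto
    then have "(real (Max A) - real (Min A)) * \<bar>h\<bar> \<le> T"
      using le by (simp add: left_diff_distrib[symmetric] abs_mult)
    then have "real (Max A) - real (Min A) \<le> T / \<bar>h\<bar>"
      using assms by (simp add: field_simps)
    ultimately show ?thesis by linarith
  qed (use assms in simp)
  then show ?thesis by (simp only: A_def)
qed

text \<open>
  The key estimate. As \<open>f\<close> may be large near \<open>-(j * h)\<close>, the integrals of the single
  translates need not be bounded by a multiple of \<open>T\<close> uniformly in \<open>j\<close>, but their average
  over the first \<open>j\<close> translates is. If \<open>j * \<bar>h\<bar> \<le> T\<close>, all translates of \<open>{0..T}\<close> lie in \<open>{-2*T..2*T}\<close>.
  Otherwise they lie in \<open>{-R..R}\<close> with \<open>R = 2 * j * \<bar>h\<bar>\<close>, and a point belongs to at most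
  \<open>T / \<bar>h\<bar> + 1\<close> of them.
\<close>

lemma sum_integral_shifts_le:
  fixes f :: "real \<Rightarrow> complex"
  assumes f: "\<And>a b. f absolutely_integrable_on {a..b}" and C: "C \<ge> 0"
    and growth: "\<And>T. T \<ge> 0 \<Longrightarrow> integral {-T..T} (\<lambda>x. norm (f x)) \<le> C * (T + 1)"
    and T: "T \<ge> 1"
  shows "(\<Sum>i=1..j. integral {0..T} (\<lambda>x. norm (f (x - real i * h)))) \<le> 2 * C * (2 + \<bar>h\<bar>) * T * real j"
proof (cases "real j * \<bar>h\<bar> \<le> T")
  case True
  have nf: "(\<lambda>x. norm (f x)) integrable_on {a..b}" for a b
    using f by (simp add: absolutely_integrable_on_def)
  have "integral {0..T} (\<lambda>x. norm (f (x - real i * h))) \<le> 2 * C * (2 + \<bar>h\<bar>) * T" if "i \<in> {1..j}" for i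
  proof -
    have "real i * \<bar>h\<bar> \<le> real j * \<bar>h\<bar>" using that by (intro mult_right_mono) auto
    then have "\<bar>real i * h\<bar> \<le> T" using True by (simp add: abs_mult)
    then have "integral {0 - real i * h..T - real i * h} (\<lambda>x. norm (f x)) \<le> integral {-(2*T)..2*T} (\<lambda>x. norm (f x))"
      by (intro integral_subset_le nf) auto
    also have "\<dots> \<le> C * (2 * T + 1)" using growth[of "2 * T"] T by simp
    also have "\<dots> \<le> C * (2 * (2 + \<bar>h\<bar>) * T)"
      using T C by (intro mult_left_mono) (auto simp: algebra_simps intro!: add_increasing2)
    finally show ?thesis by (simp add: integral_norm_shift[OF f] mult_ac)
  qed
  from sum_bounded_above[OF this, of "{1..j}"] show ?thesis by (simp add: mult_ac)
next
  case False
  then have h: "h \<noteq> 0" and j: "real j \<ge> 1" using T by (auto intro!: Suc_leI simp: Suc_le_eq intro: gr0I)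
  have nf: "(\<lambda>x. norm (f x)) integrable_on {a..b}" for a b
    using f by (simp add: absolutely_integrable_on_def)
  define R where "R = 2 * (real j * \<bar>h\<bar>)"
  have "((\<lambda>x. \<Sum>i=1..j. if x \<in> {- (real i * h)..T - real i * h} then norm (f x) else 0) has_integral
      (\<Sum>i=1..j. integral {0..T} (\<lambda>x. norm (f (x - real i * h))))) {-R..R}"
  proof (intro has_integral_sum finite_atLeastAtMost)
    fix i assume i: "i \<in> {1..j}"
    have "real i * \<bar>h\<bar> \<le> real j * \<bar>h\<bar>" using i by (intro mult_right_mono) auto
    then have "\<bar>real i * h\<bar> \<le> real j * \<bar>h\<bar>" by (simp add: abs_mult)
    then have "{- (real i * h)..T - real i * h} \<subseteq> {-R..R}" using False by (auto simp: R_def)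
    moreover have "((\<lambda>x. norm (f x)) has_integral integral {0..T} (\<lambda>x. norm (f (x - real i * h)))) {- (real i * h)..T - real i * h}"
      using integrable_integral[OF nf] by (simp add: integral_norm_shift[OF f])
    ultimately show "((\<lambda>x. if x \<in> {- (real i * h)..T - real i * h} then norm (f x) else 0) has_integral
      integral {0..T} (\<lambda>x. norm (f (x - real i * h)))) {-R..R}"
      by (simp only: has_integral_restrict)
  qed
  moreover have "((\<lambda>x. (T / \<bar>h\<bar> + 1) * norm (f x)) has_integral
      (T / \<bar>h\<bar> + 1) * integral {-R..R} (\<lambda>x. norm (f x))) {-R..R}"
    by (intro has_integral_mult_right integrable_integral nf)
  moreover have "(\<Sum>i=1..j. if x \<in> {- (real i * h)..T - real i * h} then norm (f x) else 0)
      \<le> (T / \<bar>h\<bar> + 1) * norm (f x)" for x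
  proof -
    have "(\<Sum>i=1..j. if x \<in> {- (real i * h)..T - real i * h} then norm (f x) else 0) =
        real (card {i \<in> {1..j}. x \<in> {- (real i * h)..T - real i * h}}) * norm (f x)"
      by (subst sum.inter_filter[symmetric]) auto
    also have "\<dots> \<le> (T / \<bar>h\<bar> + 1) * norm (f x)"
      using h T by (intro mult_right_mono card_translates_le) auto
    finally show ?thesis .
  qed
  ultimately have "(\<Sum>i=1..j. integral {0..T} (\<lambda>x. norm (f (x - real i * h))))
      \<le> (T / \<bar>h\<bar> + 1) * integral {-R..R} (\<lambda>x. norm (f x))"
    by (rule has_integral_le)
  also have "\<dots> \<le> (T / \<bar>h\<bar> + 1) * (C * (R + 1))"
    using T by (intro mult_left_mono growth) (auto simp: R_def)
  also have "\<dots> = C * (2 * real j * T + T / \<bar>h\<bar> + 2 * real j * \<bar>h\<bar> + 1)"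
    using h by (simp add: R_def field_simps)
  also have "\<dots> \<le> C * (2 * (2 + \<bar>h\<bar>) * T * real j)"
  proof (rule mult_left_mono[OF _ C])
    have "T / \<bar>h\<bar> \<le> real j" using False h by (simp add: field_simps)
    moreover have "2 * real j * 1 \<le> 2 * real j * T" using T by (intro mult_left_mono) auto
    moreover have "2 * real j * \<bar>h\<bar> * 1 \<le> 2 * real j * \<bar>h\<bar> * T" using T by (intro mult_left_mono) auto
    moreover have "2 * (2 + \<bar>h\<bar>) * T * real j = 2 * (2 * real j * T) + 2 * real j * \<bar>h\<bar> * T"
      by (simp add: algebra_simps)
    ultimately show "2 * real j * T + T / \<bar>h\<bar> + 2 * real j * \<bar>h\<bar> + 1 \<le> 2 * (2 + \<bar>h\<bar>) * T * real j"
      using j by linarith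
  qed
  finally show ?thesis by (simp add: mult_ac)
qed

text \<open>
  Monotone and dominated convergence for series, transferred to gauge integrals. Off the
  negligible set the series converges, so that constant factors may be moved through the
  pointwise sum.
\<close>

lemma
  fixes f :: "nat \<Rightarrow> real \<Rightarrow> complex"
  assumes S: "S \<in> sets lebesgue" and f: "\<And>i. f i absolutely_integrable_on S"
    and sm: "summable (\<lambda>i. integral S (\<lambda>x. norm (f i x)))"
  shows summable_off_negligible: "\<exists>N. negligible N \<and> (\<forall>x\<in>S - N. summable (\<lambda>i. f i x))"
    and integral_sums: "(\<lambda>i. integral S (f i)) sums integral S (\<lambda>x. \<Sum>i. f i x)"
proof -
  let ?M = "lebesgue_on S"
  have fi: "integrable ?M (f i)" for i
    using f[of i] S by (simp add: set_integrable_eq)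
  have nint: "(\<integral>x. norm (f i x) \<partial>?M) = integral S (\<lambda>x. norm (f i x))" for i
    using fi S by (intro lebesgue_integral_eq_integral integrable_norm)
  have nn: "0 \<le> integral S (\<lambda>x. norm (f i x))" for i
    unfolding nint[symmetric] by simp
  have "(\<integral>\<^sup>+x. (\<Sum>i. ennreal (norm (f i x))) \<partial>?M) = (\<Sum>i. \<integral>\<^sup>+x. ennreal (norm (f i x)) \<partial>?M)"
    using fi by (intro nn_integral_suminf) auto
  also have "\<dots> = (\<Sum>i. ennreal (integral S (\<lambda>x. norm (f i x))))"
    using fi by (simp add: nn_integral_eq_integral nint)
  also have "\<dots> \<noteq> \<infinity>"
    using sm nn by (simp add: ennreal_suminf_neq_top)
  finally have fin: "(\<integral>\<^sup>+x. (\<Sum>i. ennreal (norm (f i x))) \<partial>?M) \<noteq> \<infinity>" .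
  have "AE x in ?M. (\<Sum>i. ennreal (norm (f i x))) \<noteq> \<infinity>"
    using fi by (intro nn_integral_PInf_AE[OF _ fin]) auto
  then have ae: "AE x in ?M. summable (\<lambda>i. norm (f i x))"
    by eventually_elim (auto intro: summable_suminf_not_top)
  then have "AE x in lebesgue. x \<in> S \<longrightarrow> summable (\<lambda>i. norm (f i x))"
    using S by (simp add: AE_restrict_space_iff)
  then obtain N where "negligible N" "{x. \<not> (x \<in> S \<longrightarrow> summable (\<lambda>i. norm (f i x)))} \<subseteq> N"
    unfolding eventually_ae_filter_negligible by blast
  then show "\<exists>N. negligible N \<and> (\<forall>x\<in>S - N. summable (\<lambda>i. f i x))"
    by (intro exI[of _ N]) (auto intro: summable_norm_cancel)
  have sm': "summable (\<lambda>i. \<integral>x. norm (f i x) \<partial>?M)" using sm by (simp add: nint)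
  have "(\<lambda>i. integral\<^sup>L ?M (f i)) sums (\<integral>x. (\<Sum>i. f i x) \<partial>?M)"
    using fi ae sm' by (rule sums_integral)
  moreover have "integrable ?M (\<lambda>x. \<Sum>i. f i x)"
    using fi ae sm' by (rule integrable_suminf)
  ultimately show "(\<lambda>i. integral S (f i)) sums integral S (\<lambda>x. \<Sum>i. f i x)"
    using fi S by (simp add: lebesgue_integral_eq_integral)
qed

section \<open>Fourier coefficients of fractional differences\<close>

text \<open>
  Term by term the claim is the rule for translates, so the point is to interchange the
  series with the limit of the means. Since \<open>j * norm (a j)\<close> tends to 0 but need not be
  summable (for the binomial coefficients it is not if \<open>\<alpha> < 1\<close>), bounding the terms one by
  one does not suffice. Summation by parts together with the averaged bound on translates
  gives a tail of at most \<open>K * \<eta> J\<close> for the means over \<open>{0..T}\<close>, with \<open>\<eta> J\<close> tending to 0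
  and independent of \<open>T \<ge> 1\<close>. The resulting uniform convergence permits the interchange.
\<close>

lemma fourier_coeff_series_of_shifts:
  fixes a :: "nat \<Rightarrow> complex"
  assumes f: "B_almost_periodic f"
    and sm: "summable (\<lambda>j. norm (a j))" and lim: "(\<lambda>j. real j * norm (a j)) \<longlonglongrightarrow> 0"
    and dec: "\<And>j. J\<^sub>0 \<le> j \<Longrightarrow> norm (a (Suc j)) \<le> norm (a j)"
  shows "fourier_coeff (\<lambda>x. \<Sum>j. a j * f (x - real j * h)) l =
    (\<Sum>j. a j * exp (- \<i> * of_real (l * h)) ^ j) * fourier_coeff f l"
proof -
  have ai: "f absolutely_integrable_on {u..v}" for u v
    using f unfolding B_almost_periodic_def by blast
  obtain C where C: "C \<ge> 0" "\<And>T. T \<ge> 0 \<Longrightarrow> integral {-T..T} (\<lambda>x. norm (f x)) \<le> C * (T + 1)"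
    using B_almost_periodic_growth[OF f] by blast
  define c where "c j = norm (a j)" for j
  define K where "K = 2 * C * (2 + \<bar>h\<bar>)"
  have K: "K \<ge> 0" using C by (simp add: K_def)
  define F where "F j T = integral {0..T} (\<lambda>x. norm (f (x - real j * h)))" for j T
  define u where "u j x = a j * (f (x - real j * h) * exp (- \<i> * of_real (l * x)))" for j x
  \<comment> \<open>\<open>K * T * \<eta> J\<close> is the bound that summation by parts yields for the terms beyond \<open>J\<close>.\<close>
  define \<eta> where "\<eta> J = real J * c J + (suminf c - (\<Sum>i\<le>J. c i))" for J
  have c: "0 \<le> c j" "summable c" for j using sm by (simp_all add: c_def[abs_def])
  have eta: "\<eta> \<longlonglongrightarrow> 0"
    using tendsto_add[OF lim tendsto_diff[OF tendsto_const[of "suminf c"] summable_LIMSEQ'[OF c(2)]]]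
    by (simp add: \<eta>_def[abs_def] c_def)
  have shift: "(\<lambda>x. f (x - s)) absolutely_integrable_on {v..w}" for s v w
    by (rule absolutely_integrable_shift[OF ai])
  have F: "0 \<le> F j T" for j T
    unfolding F_def using shift by (intro Henstock_Kurzweil_Integration.integral_nonneg) (auto simp: absolutely_integrable_on_def)
  have uai: "u j absolutely_integrable_on {v..w}" for j v w
    unfolding u_def by (intro set_integrable_mult_right absolutely_integrable_mult_character shift)
  have nu: "(\<lambda>x. norm (u j x)) = (\<lambda>x. c j * norm (f (x - real j * h)))" for j
    by (simp add: u_def c_def norm_mult)
  have intu: "integral {0..T} (\<lambda>x. norm (u j x)) = c j * F j T" for j T
    by (simp add: nu F_def)
  have tail: "(\<Sum>i=Suc J..N. c i * F i T) \<le> K * T * \<eta> J" if "J\<^sub>0 \<le> J" "1 \<le> T" for J N T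
  proof -
    have "(\<Sum>i=Suc J..N. c i * F i T) \<le> K * T * (real J * c J + (\<Sum>i=Suc J..N. c i))"
    proof (rule abel_tail_bound)
      show "(\<Sum>i=1..j. F i T) \<le> K * T * real j" for j
        unfolding F_def K_def by (rule sum_integral_shifts_le[OF ai C that(2)])
    qed (use F c that dec in \<open>auto simp: c_def\<close>)
    also have "(\<Sum>i=Suc J..N. c i) \<le> suminf c - (\<Sum>i\<le>J. c i)"
    proof -
      have "(\<Sum>i\<le>J. c i) + (\<Sum>i=Suc J..N. c i) = (\<Sum>i\<in>{..J} \<union> {Suc J..N}. c i)"
        by (rule sum.union_disjoint[symmetric]) auto
      also have "\<dots> \<le> suminf c" using c by (intro sum_le_suminf) auto
      finally show ?thesis by simp
    qed
    finally show ?thesis using K that by (simp add: \<eta>_def mult_left_mono)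
  qed
  have sF: "summable (\<lambda>i. c i * F i T)" if "1 \<le> T" for T
  proof (rule bounded_imp_summable)
    show "0 \<le> c i * F i T" for i using c F by simp
    fix n
    have "(\<Sum>i\<le>n. c i * F i T) \<le> (\<Sum>i\<in>{..J\<^sub>0} \<union> {Suc J\<^sub>0..n}. c i * F i T)"
      using c F by (intro sum_mono2) auto
    also have "\<dots> = (\<Sum>i\<le>J\<^sub>0. c i * F i T) + (\<Sum>i=Suc J\<^sub>0..n. c i * F i T)"
      by (rule sum.union_disjoint) auto
    also have "\<dots> \<le> (\<Sum>i\<le>J\<^sub>0. c i * F i T) + K * T * \<eta> J\<^sub>0" using tail[OF _ that] by simp
    finally show "(\<Sum>i\<le>n. c i * F i T) \<le> (\<Sum>i\<le>J\<^sub>0. c i * F i T) + K * T * \<eta> J\<^sub>0" .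
  qed
  define H where "H T = integral {0..T} (\<lambda>x. (\<Sum>j. a j * f (x - real j * h)) * exp (- \<i> * of_real (l * x)))" for T
  have H: "(\<lambda>j. integral {0..T} (u j)) sums H T" if T: "1 \<le> T" for T
  proof -
    have su: "summable (\<lambda>j. integral {0..T} (\<lambda>x. norm (u j x)))"
      unfolding intu by (rule sF[OF T])
    obtain N where N: "negligible N" "\<And>x. x \<in> {0..T} - N \<Longrightarrow> summable (\<lambda>j. u j x)"
      using summable_off_negligible[OF _ uai su] by auto
    \<comment> \<open>Where the series diverges, \<open>suminf\<close> is a default value that need not commute with the
      factor \<open>exp\<close>; these points are negligible.\<close>
    have "H T = integral {0..T} (\<lambda>x. \<Sum>j. u j x)"
      unfolding H_def
    proof (rule integral_spike[OF N(1)])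
      fix x assume x: "x \<in> {0..T} - N"
      have "(\<lambda>j. u j x * exp (\<i> * of_real (l * x))) = (\<lambda>j. a j * f (x - real j * h))"
        by (simp add: u_def fun_eq_iff mult.assoc exp_add[symmetric])
      then have "summable (\<lambda>j. a j * f (x - real j * h))"
        using summable_mult2[OF N(2)[OF x], of "exp (\<i> * of_real (l * x))"] by simp
      then show "(\<Sum>j. u j x) = (\<Sum>j. a j * f (x - real j * h)) * exp (- \<i> * of_real (l * x))"
        by (simp add: suminf_mult2 u_def mult.assoc)
    qed
    then show ?thesis using integral_sums[OF _ uai su] by simp
  qed
  have trunc: "norm (H T - (\<Sum>j\<le>J. integral {0..T} (u j))) \<le> K * T * \<eta> J"
    if "J\<^sub>0 \<le> J" "1 \<le> T" for J T
  proof (rule LIMSEQ_le_const2)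
    have "(\<lambda>N. \<Sum>j\<le>N. integral {0..T} (u j)) \<longlonglongrightarrow> H T"
      using H[OF that(2)] by (simp add: sums_def_le)
    then show "(\<lambda>N. norm ((\<Sum>j\<le>N. integral {0..T} (u j)) - (\<Sum>j\<le>J. integral {0..T} (u j))))
        \<longlonglongrightarrow> norm (H T - (\<Sum>j\<le>J. integral {0..T} (u j)))"
      by (intro tendsto_intros)
    have "norm ((\<Sum>j\<le>N. integral {0..T} (u j)) - (\<Sum>j\<le>J. integral {0..T} (u j))) \<le> K * T * \<eta> J" if N: "N \<ge> J" for N
    proof -
      have "{..N} = {..J} \<union> {Suc J..N}" using N by auto
      then have "(\<Sum>j\<le>N. integral {0..T} (u j)) =
          (\<Sum>j\<le>J. integral {0..T} (u j)) + (\<Sum>j=Suc J..N. integral {0..T} (u j))"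
        by (simp add: sum.union_disjoint)
      then have "norm ((\<Sum>j\<le>N. integral {0..T} (u j)) - (\<Sum>j\<le>J. integral {0..T} (u j))) =
          norm (\<Sum>j=Suc J..N. integral {0..T} (u j))" by simp
      also have "\<dots> \<le> (\<Sum>j=Suc J..N. c j * F j T)"
      proof (rule sum_norm_le)
        fix j
        have "norm (integral {0..T} (u j)) \<le> integral {0..T} (\<lambda>x. norm (u j x))"
          using uai[where j = j and v = 0 and w = T]
          by (intro Henstock_Kurzweil_Integration.integral_norm_bound_integral) (auto simp: absolutely_integrable_on_def)
        then show "norm (integral {0..T} (u j)) \<le> c j * F j T" by (simp only: intu)
      qed
      also have "\<dots> \<le> K * T * \<eta> J" by (rule tail[OF \<open>J\<^sub>0 \<le> J\<close> \<open>1 \<le> T\<close>])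
      finally show ?thesis .
    qed
    then show "\<exists>M. \<forall>N\<ge>M. norm ((\<Sum>j\<le>N. integral {0..T} (u j)) - (\<Sum>j\<le>J. integral {0..T} (u j))) \<le> K * T * \<eta> J"
      by blast
  qed
  let ?P = "\<lambda>J T::real. \<Sum>j\<le>J. of_real (1 / T) * integral {0..T} (u j)"
  let ?w = "exp (- \<i> * complex_of_real (l * h))"
  have ul: "uniform_limit {1..} ?P (\<lambda>T. of_real (1 / T) * H T) sequentially"
  proof (rule uniform_limitI)
    fix e :: real assume "e > 0"
    have "(\<lambda>J. K * \<eta> J) \<longlonglongrightarrow> 0" using tendsto_mult_right_zero[OF eta] .
    then have "eventually (\<lambda>J. K * \<eta> J < e) sequentially"
      using \<open>e > 0\<close> by (rule order_tendstoD)
    then show "eventually (\<lambda>J. \<forall>T\<in>{1..}. dist (?P J T) (of_real (1 / T) * H T) < e) sequentially"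
      using eventually_ge_at_top[of J\<^sub>0]
    proof eventually_elim
      case (elim J)
      show ?case
      proof
        fix T :: real assume T: "T \<in> {1..}"
        have "dist (?P J T) (of_real (1 / T) * H T) =
            norm (of_real (1 / T) * (H T - (\<Sum>j\<le>J. integral {0..T} (u j))))"
          unfolding dist_norm by (subst norm_minus_commute) (simp only: right_diff_distrib sum_distrib_left)
        also have "\<dots> = (1 / T) * norm (H T - (\<Sum>j\<le>J. integral {0..T} (u j)))"
          using T by (simp add: norm_mult norm_divide)
        also have "\<dots> \<le> (1 / T) * (K * T * \<eta> J)"
          using trunc[of J T] elim T by (intro mult_left_mono) auto
        also have "\<dots> = K * \<eta> J" using T by simp
        finally show "dist (?P J T) (of_real (1 / T) * H T) < e" using elim by simp
      qed
    qed
  qed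
  have "((\<lambda>T. of_real (1 / T) * H T) \<longlongrightarrow> (\<Sum>j. a j * ?w ^ j) * fourier_coeff f l) at_top"
  proof (rule swap_uniform_limit'[OF _ _ ul])
    show "eventually (\<lambda>J. (?P J \<longlongrightarrow> (\<Sum>j\<le>J. a j * ?w ^ j) * fourier_coeff f l) at_top) sequentially"
    proof (intro always_eventually allI)
      fix J
      have "((\<lambda>T::real. \<Sum>j\<le>J. a j * (of_real (1 / T) *
          integral {0..T} (\<lambda>x. f (x - real j * h) * exp (- \<i> * of_real (l * x)))))
          \<longlongrightarrow> (\<Sum>j\<le>J. a j * (exp (- \<i> * of_real (l * (real j * h))) * fourier_coeff f l))) at_top"
        by (intro tendsto_intros mean_shift_tendsto f)
      moreover have "exp (- \<i> * of_real (l * (real j * h))) = ?w ^ j" for j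
        by (simp add: exp_of_nat_mult[symmetric] mult_ac)
      moreover have "(\<lambda>T::real. a j * (of_real (1 / T) *
          integral {0..T} (\<lambda>x. f (x - real j * h) * exp (- \<i> * of_real (l * x))))) =
          (\<lambda>T. of_real (1 / T) * integral {0..T} (u j))" for j
        by (auto simp: u_def[abs_def] fun_eq_iff)
      then have "a j * (of_real (1 / T) *
          integral {0..T} (\<lambda>x. f (x - real j * h) * exp (- \<i> * of_real (l * x)))) =
          of_real (1 / T) * integral {0..T} (u j)" for j and T :: real
        by (rule fun_cong)
      ultimately show "(?P J \<longlongrightarrow> (\<Sum>j\<le>J. a j * ?w ^ j) * fourier_coeff f l) at_top"
        by (simp only: sum_distrib_right mult.assoc)
    qed
    have "summable (\<lambda>j. norm (a j * ?w ^ j))" using sm by (simp add: norm_mult norm_power)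
    then have "summable (\<lambda>j. a j * ?w ^ j)" by (rule summable_norm_cancel)
    then show "(\<lambda>J. (\<Sum>j\<le>J. a j * ?w ^ j) * fourier_coeff f l) \<longlonglongrightarrow> (\<Sum>j. a j * ?w ^ j) * fourier_coeff f l"
      by (rule tendsto_mult_right[OF summable_LIMSEQ'])
    show "eventually (\<lambda>T::real. T \<in> {1..}) at_top"
      using eventually_ge_at_top[of "1::real"] by simp
  qed simp
  then show ?thesis
    unfolding fourier_coeff_def[of "\<lambda>x. \<Sum>j. a j * f (x - real j * h)"] mean_value_def H_def
    by (intro tendsto_Lim) auto
qed

text \<open>
  The difference acts on the frequency \<open>l\<close> as the multiplier \<open>(1 - exp (-\<i> l h)) powr \<alpha>\<close>.
\<close>

lemma norm_fourier_coeff_fractional_difference: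
  assumes "B_almost_periodic f" "\<alpha> > 0"
  shows "norm (fourier_coeff (fractional_difference \<alpha> h f) l) =
    (2 * \<bar>sin (l * h / 2)\<bar>) powr \<alpha> * norm (fourier_coeff f l)"
proof -
  define a where "a j = (-1) ^ j * complex_of_real (\<alpha> gchoose j)" for j
  have na: "norm (a j) = \<bar>\<alpha> gchoose j\<bar>" for j by (simp add: a_def norm_mult norm_power)
  have "fourier_coeff (\<lambda>x. \<Sum>j. a j * f (x - real j * h)) l =
    (\<Sum>j. a j * exp (- \<i> * of_real (l * h)) ^ j) * fourier_coeff f l"
  proof (rule fourier_coeff_series_of_shifts[OF assms(1), where J\<^sub>0 = "nat \<lceil>\<alpha>\<rceil>"])
    show "norm (a (Suc j)) \<le> norm (a j)" if "nat \<lceil>\<alpha>\<rceil> \<le> j" for j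
      unfolding na using assms that by (intro abs_gbinomial_decreasing) linarith+
  qed (unfold na, fact summable_abs_gbinomial[OF assms(2)],
      fact index_mult_abs_gbinomial_tendsto_0[OF assms(2)])
  moreover have "norm (\<Sum>j. a j * exp (- \<i> * of_real (l * h)) ^ j) = (2 * \<bar>sin (l * h / 2)\<bar>) powr \<alpha>"
    unfolding a_def
    by (subst norm_binomial_series_unit_circle[OF assms(2)], simp, subst norm_one_minus_cis, rule refl)
  moreover have "fractional_difference \<alpha> h f = (\<lambda>x. \<Sum>j. a j * f (x - real j * h))"
    by (simp add: fun_eq_iff fractional_difference_def a_def)
  ultimately show ?thesis by (simp only: norm_mult)
qed

section \<open>Best approximation\<close>

lemma B_almost_periodic_0: "B_almost_periodic (\<lambda>x. 0)"
  unfolding B_almost_periodic_def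
proof (intro conjI allI exI)
  show "(\<lambda>x. 0 :: complex) absolutely_integrable_on {a..b}" for a b :: real by simp
  show "(\<lambda>N. Limsup at_top (\<lambda>T::real. ereal (1 / (2 * T) *
      integral {-T..T} (\<lambda>x. norm (0 - trig_sum N ((\<lambda>_ _. 0) N) ((\<lambda>_ _. 0) N) x))))) \<longlonglongrightarrow> 0"
    by (simp add: trig_sum_def Limsup_const flip: zero_ereal_def)
qed

lemma fourier_coeff_0: "fourier_coeff (\<lambda>x. 0) l = 0"
  using fourier_coeff_diff[OF B_almost_periodic_0 B_almost_periodic_0, of l] by simp

text \<open>
  Subtracting \<open>g \<in> G s\<close> does not change the Fourier coefficients at frequencies \<open>\<bar>l\<bar> \<ge> s\<close>.
  Taking \<open>g = 0\<close> shows that the infimum is over a non-empty set.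
\<close>

lemma tail_le_best_approx:
  assumes "p > 0" "f \<in> BS p"
  shows "(\<Sum>\<^sub>\<infinity>l\<in>{l. s \<le> \<bar>l\<bar>}. norm (fourier_coeff f l) powr p) \<le> best_approx p s f powr p"
proof -
  let ?t = "\<Sum>\<^sub>\<infinity>l\<in>{l. s \<le> \<bar>l\<bar>}. norm (fourier_coeff f l) powr p"
  have f: "B_almost_periodic f" "(\<lambda>l. norm (fourier_coeff f l) powr p) summable_on UNIV"
    using assms(2) by (auto simp: BS_def)
  have t0: "?t \<ge> 0" by (intro infsum_nonneg) simp
  have "?t powr (1 / p) \<le> best_approx p s f"
    unfolding best_approx_def
  proof (rule cINF_greatest)
    have "(\<lambda>x. 0) \<in> {g \<in> G s. (\<lambda>x. f x - g x) \<in> BS p}"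
      using assms(2) by (simp add: G_def B_almost_periodic_0 fourier_exponents_def fourier_coeff_0)
    then show "{g \<in> G s. (\<lambda>x. f x - g x) \<in> BS p} \<noteq> {}" by blast
    fix g assume g: "g \<in> {g \<in> G s. (\<lambda>x. f x - g x) \<in> BS p}"
    then have bg: "B_almost_periodic g" "fourier_exponents g \<subseteq> {-s<..<s}"
      and sm: "(\<lambda>l. norm (fourier_coeff (\<lambda>x. f x - g x) l) powr p) summable_on UNIV"
      by (auto simp: G_def BS_def)
    have eq: "fourier_coeff (\<lambda>x. f x - g x) l = fourier_coeff f l" if "s \<le> \<bar>l\<bar>" for l
    proof -
      have "l \<notin> fourier_exponents g" using subsetD[OF bg(2), of l] that by auto
      then have "fourier_coeff g l = 0" by (simp add: fourier_exponents_def)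
      then show ?thesis by (simp add: fourier_coeff_diff f bg)
    qed
    have "?t \<le> (\<Sum>\<^sub>\<infinity>l\<in>UNIV. norm (fourier_coeff (\<lambda>x. f x - g x) l) powr p)"
      by (rule infsum_mono_neutral[OF summable_on_subset_banach[OF f(2)] sm]) (auto simp: eq)
    then show "?t powr (1 / p) \<le> BS_norm p (\<lambda>x. f x - g x)"
      unfolding BS_norm_def using t0 assms by (intro powr_mono2) auto
  qed
  then have "(?t powr (1 / p)) powr p \<le> best_approx p s f powr p"
    using assms by (intro powr_mono2) auto
  then show ?thesis using assms t0 by (simp add: powr_powr)
qed

section \<open>Bounding the modulus of smoothness\<close>

text \<open>
  The terms with \<open>L \<nu> \<le> L m\<close> are those with \<open>\<nu> \<le> m\<close>, and they telescope;
  \<open>L 0 powr q = 0 powr q = 0\<close> disposes of the lower end.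
\<close>

lemma sum_increments_below:
  fixes L :: "nat \<Rightarrow> real"
  assumes "strict_mono L" "L 0 = 0"
  shows "(\<Sum>\<nu>=1..n. (L \<nu> powr q - L (\<nu> - 1) powr q) * of_bool (L \<nu> \<le> L m)) = L (min m n) powr q"
proof (induction n)
  case (Suc n)
  then show ?case
    using assms by (cases "Suc n \<le> m") (auto simp: strict_mono_less_eq min_def)
qed (use assms in simp)

text \<open>
  For low frequencies \<open>\<bar>sin x\<bar> \<le> \<bar>x\<bar>\<close> gives the factor \<open>\<bar>l\<bar> * \<bar>h\<bar> \<le> L m * (pi / L n)\<close>;
  from \<open>m \<ge> n\<close> on, \<open>\<bar>sin x\<bar> \<le> 1\<close> and \<open>2 \<le> pi\<close> give the factor \<open>pi\<close>.
\<close>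

lemma norm_fourier_coeff_fractional_difference_le:
  fixes L :: "nat \<Rightarrow> real"
  assumes "B_almost_periodic f" "\<alpha> > 0" "p > 0"
    and L: "strict_mono L" "L 0 = 0" and n: "n \<ge> 1" and l: "\<bar>l\<bar> = L m"
    and h: "\<bar>h\<bar> \<le> pi / L n"
  shows "norm (fourier_coeff (fractional_difference \<alpha> h f) l) powr p \<le>
    (pi / L n) powr (\<alpha> * p) * L (min m n) powr (\<alpha> * p) * norm (fourier_coeff f l) powr p"
proof -
  have "0 < n" using n by simp
  then have Ln: "L n > 0" using strict_monoD[OF L(1), of 0 n] L(2) by simp
  have Lm: "L k \<ge> 0" for k using strict_mono_mono[OF L(1)] L(2) by (metis monoD zero_le)
  have "2 * \<bar>sin (l * h / 2)\<bar> \<le> pi / L n * L (min m n)"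
  proof (cases "m < n")
    case True
    have "2 * \<bar>sin (l * h / 2)\<bar> \<le> \<bar>l\<bar> * \<bar>h\<bar>"
      using abs_sin_x_le_abs_x[of "l * h / 2"] by (simp add: abs_mult)
    also have "\<dots> \<le> L m * (pi / L n)"
      unfolding l using h Lm by (rule mult_left_mono)
    finally show ?thesis using True by (simp add: mult.commute)
  next
    case False
    have "2 * \<bar>sin (l * h / 2)\<bar> \<le> 2" by simp
    also have "\<dots> \<le> pi" using pi_ge_two .
    finally show ?thesis using False Ln by (simp add: min_def)
  qed
  then have "((2 * \<bar>sin (l * h / 2)\<bar>) powr \<alpha> * norm (fourier_coeff f l)) powr p
      \<le> ((pi / L n * L (min m n)) powr \<alpha> * norm (fourier_coeff f l)) powr p"
    using assms by (intro powr_mono2 mult_right_mono) auto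
  also have "\<dots> = (pi / L n) powr (\<alpha> * p) * L (min m n) powr (\<alpha> * p) * norm (fourier_coeff f l) powr p"
    by (simp only: powr_mult powr_powr)
  finally show ?thesis by (simp add: norm_fourier_coeff_fractional_difference assms)
qed

lemma has_sum_sum_of_bool:
  fixes g :: "'a \<Rightarrow> real"
  assumes "g summable_on UNIV"
  shows "((\<lambda>l. (\<Sum>\<nu>\<in>I. d \<nu> * of_bool (P \<nu> l)) * g l) has_sum (\<Sum>\<nu>\<in>I. d \<nu> * (\<Sum>\<^sub>\<infinity>l\<in>{l. P \<nu> l}. g l))) UNIV"
proof (induction I rule: infinite_finite_induct)
  case (insert \<nu> I)
  have "(g has_sum (\<Sum>\<^sub>\<infinity>l\<in>{l. P \<nu> l}. g l)) {l. P \<nu> l}"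
    using summable_on_subset_banach[OF assms] by simp
  then have "((\<lambda>l. of_bool (P \<nu> l) * g l) has_sum (\<Sum>\<^sub>\<infinity>l\<in>{l. P \<nu> l}. g l)) UNIV"
    by (subst has_sum_cong_neutral[where g = g and T = "{l. P \<nu> l}"]) auto
  from has_sum_add[OF has_sum_cmult_right[OF this, of "d \<nu>"] insert.IH]
  show ?case by (simp only: sum.insert[OF insert.hyps] distrib_right mult.assoc)
qed auto

lemma symmetric_form_sequence:
  assumes "symmetric_form f lam"
  shows "strict_mono (\<lambda>m. lam (int m))" "lam 0 = 0"
    and "fourier_coeff f l \<noteq> 0 \<Longrightarrow> \<exists>m. \<bar>l\<bar> = lam (int m)"
proof -
  have lam: "lam 0 = 0" "\<And>k. lam (- k) = - lam k" "\<And>k. k > 0 \<Longrightarrow> lam (k + 1) > lam k"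
    "\<And>k. k > 0 \<Longrightarrow> lam k > 0" "fourier_exponents f \<subseteq> range lam"
    using assms unfolding symmetric_form_def by auto
  show mono: "strict_mono (\<lambda>m. lam (int m))"
    unfolding strict_mono_Suc_iff
  proof
    fix m
    show "lam (int m) < lam (int (Suc m))"
      using lam(1) lam(3)[of "int m"] lam(4)[of 1] by (cases "m = 0") (auto simp: add.commute)
  qed
  show "lam 0 = 0" by (rule lam)
  assume "fourier_coeff f l \<noteq> 0"
  then obtain k where k: "l = lam k" using lam(5) by (auto simp: fourier_exponents_def)
  have pos: "lam (int m) \<ge> 0" for m using lam(1) lam(4)[of "int m"] by (cases "m = 0") auto
  show "\<exists>m. \<bar>l\<bar> = lam (int m)"
  proof (cases k rule: int_cases2)
    case (nonneg m)
    then show ?thesis using k pos by auto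
  next
    case (nonpos m)
    then show ?thesis using k pos[of m] lam(2)[of "int m"] by auto
  qed
qed

theorem mainTheorem2:
  fixes p \<alpha> :: real and f :: "real \<Rightarrow> complex" and lam :: "int \<Rightarrow> real" and n :: nat
  assumes "1 \<le> p"
    and "f \<in> BS p"
    and "symmetric_form f lam"
    and "n \<ge> 1"
    and "\<alpha> > 0"
  shows "modulus_of_smoothness p \<alpha> f (pi / lam (int n)) powr p
    \<le> (pi / lam (int n)) powr (\<alpha> * p) *
      (\<Sum>\<nu>=1..n. (lam (int \<nu>) powr (\<alpha> * p) - lam (int \<nu> - 1) powr (\<alpha> * p)) *
                  best_approx p (lam (int \<nu>)) f powr p)"
    (is "_ \<le> ?R")
proof -
  define L where "L m = lam (int m)" for m
  have L: "strict_mono L" "L 0 = 0"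
    using symmetric_form_sequence(1,2)[OF assms(3)] by (simp_all add: L_def[abs_def])
  define d where "d \<nu> = L \<nu> powr (\<alpha> * p) - L (\<nu> - 1) powr (\<alpha> * p)" for \<nu>
  define g where "g l = norm (fourier_coeff f l) powr p" for l
  define t where "t \<nu> = (\<Sum>\<^sub>\<infinity>l\<in>{l. L \<nu> \<le> \<bar>l\<bar>}. g l)" for \<nu>
  let ?c = "(pi / L n) powr (\<alpha> * p)"
  have f: "B_almost_periodic f" and g: "g summable_on UNIV"
    using assms(2) by (auto simp: BS_def g_def[abs_def])
  have Lpos: "L k \<ge> 0" for k using strict_mono_mono[OF L(1)] L(2) by (metis monoD zero_le)
  have d: "d \<nu> \<ge> 0" for \<nu>
    unfolding d_def using assms Lpos monoD[OF strict_mono_mono[OF L(1)], of "\<nu> - 1" \<nu>]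
    by (simp add: powr_mono2)
  have "?c * (\<Sum>\<nu>=1..n. d \<nu> * t \<nu>) \<le> ?c * (\<Sum>\<nu>=1..n. d \<nu> * best_approx p (L \<nu>) f powr p)"
    using assms d tail_le_best_approx[of p f] unfolding t_def g_def
    by (intro mult_left_mono sum_mono) auto
  also have "\<dots> = ?R"
  proof -
    have "int \<nu> - 1 = int (\<nu> - 1)" if "\<nu> \<in> {1..n}" for \<nu> using that by (simp add: of_nat_diff)
    then show ?thesis unfolding d_def L_def by (intro arg_cong2[where f = "(*)"] refl sum.cong) simp_all
  qed
  finally have R: "?c * (\<Sum>\<nu>=1..n. d \<nu> * t \<nu>) \<le> ?R" .
  have R0: "?c * (\<Sum>\<nu>=1..n. d \<nu> * t \<nu>) \<ge> 0"
    using d by (auto simp: t_def g_def intro!: mult_nonneg_nonneg sum_nonneg infsum_nonneg)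
  have bound: "BS_norm p (fractional_difference \<alpha> h f) \<le> ?R powr (1 / p)"
    if h: "\<bar>h\<bar> \<le> pi / L n" for h
  proof -
    let ?D = "\<lambda>l. norm (fourier_coeff (fractional_difference \<alpha> h f) l) powr p"
    let ?M = "\<lambda>l. ?c * ((\<Sum>\<nu>=1..n. d \<nu> * of_bool (L \<nu> \<le> \<bar>l\<bar>)) * g l)"
    have le: "?D l \<le> ?M l" for l
    proof (cases "fourier_coeff f l = 0")
      case True
      then show ?thesis
        using norm_fourier_coeff_fractional_difference[OF f assms(5), of h l] by (simp add: g_def)
    next
      case False
      then obtain m where m: "\<bar>l\<bar> = L m"
        using symmetric_form_sequence(3)[OF assms(3)] by (auto simp: L_def)
      have "(\<Sum>\<nu>=1..n. d \<nu> * of_bool (L \<nu> \<le> \<bar>l\<bar>)) = L (min m n) powr (\<alpha> * p)"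
        unfolding d_def m by (rule sum_increments_below[OF L])
      then show ?thesis
        using norm_fourier_coeff_fractional_difference_le[OF f assms(5) _ L assms(4) m h, of p] assms(1)
        by (simp add: g_def mult.assoc)
    qed
    have hs: "(?M has_sum (?c * (\<Sum>\<nu>=1..n. d \<nu> * t \<nu>))) UNIV"
      unfolding t_def by (intro has_sum_cmult_right has_sum_sum_of_bool g)
    have sD: "?D summable_on UNIV"
      using hs le by (intro summable_on_comparison_test[OF has_sum_imp_summable[OF hs]]) auto
    have "infsum ?D UNIV \<le> infsum ?M UNIV"
      using sD has_sum_imp_summable[OF hs] le by (rule infsum_mono)
    also have "\<dots> \<le> ?R" using infsumI[OF hs] R by simp
    finally show ?thesis
      unfolding BS_norm_def using assms by (intro powr_mono2 infsum_nonneg) auto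
  qed
  have "pi / L n > 0" using strict_monoD[OF L(1), of 0 n] L(2) assms(4) by simp
  then have ne: "0 \<in> {h. \<bar>h\<bar> \<le> pi / L n}" by simp
  have "modulus_of_smoothness p \<alpha> f (pi / L n) \<le> ?R powr (1 / p)"
    unfolding modulus_of_smoothness_def
  proof (rule cSUP_least)
    show "{h. \<bar>h\<bar> \<le> pi / L n} \<noteq> {}" using ne by blast
  qed (use bound in simp)
  \<comment> \<open>Needed for the monotonicity of \<open>powr p\<close>, which holds on non-negative arguments only.\<close>
  moreover have "0 \<le> modulus_of_smoothness p \<alpha> f (pi / L n)"
  proof -
    have "BS_norm p (fractional_difference \<alpha> 0 f) \<le> modulus_of_smoothness p \<alpha> f (pi / L n)"
      unfolding modulus_of_smoothness_def using bound
      by (intro cSUP_upper[OF ne] bdd_aboveI2[where M = "?R powr (1 / p)"]) auto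
    then show ?thesis by (rule order_trans[rotated]) (simp add: BS_norm_def)
  qed
  ultimately have "modulus_of_smoothness p \<alpha> f (pi / L n) powr p \<le> (?R powr (1 / p)) powr p"
    using assms(1) by (intro powr_mono2) auto
  also have "\<dots> = ?R" using assms(1) R R0 by (simp add: powr_powr)
  finally show ?thesis by (simp only: L_def)
qed

end
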